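(* Let $G$ be a graph with $\alpha(G)=2$ that is facet-defining and ${\rm LS}_+$-perfect. Then $G$ is an odd antihole, or $G$ is the complete join of one or more odd antiholes and a (possibly empty) clique.
   Context: All graphs are finite and simple; $\alpha(G)$ is the stability number. ${\rm STAB}(G)$ is the convex hull of incidence vectors of stable sets of $G=(V,E)$; $G$ is facet-defining if ${\rm STAB}(G)$ has a facet $a^Tx\le b$ with $a_i\neq 0$ for all $i\in V$ (full support). ${\rm ESTAB}(G)=\{x\in[0,1]^V: x_i+x_j\le 1,\ ij\in E\}$. For convex $K\subseteq[0,1]^n$: $\mathrm{cone}(K)=\{(x_0,x): x=x_0y, y\in K\}$; $M_+(K)$ is the set of symmetric positive semidefinite $(n+1)\times(n+1)$ matrices $Y$ (indices $0,\dots,n$) with $Ye_0=\mathrm{diag}(Y)$, $Ye_i\in\mathrm{cone}(K)$, $Y(e_0-e_i)\in\mathrm{cone}(K)$ for $i=1,\dots,n$; ${\rm LS}_+(K)=\{x\in[0,1]^n:(1,x)^T=Ye_0 \text{ for some } Y\in M_+(K)\}$. $G$ is ${\rm LS}_+$-perfect if ${\rm LS}_+({\rm ESTAB}(G))={\rm STAB}(G)$. An odd antihole is the complement of a chordless cycle of odd length at least 5. The complete join of graphs is their disjoint union with all edges between different parts added. *)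

theory Defs
  imports "HOL-Analysis.Analysis"
begin

text \<open>A finite simple graph is given by a finite vertex type 'n (V = UNIV) and a
  symmetric irreflexive adjacency relation E. Vectors in R^V are real^'n.
  Matrices with rows/columns indexed by 0,...,n use the index type 'n option,
  where None plays the role of the index 0 and Some i the vertex i.\<close>

definition stable_set :: "('n \<Rightarrow> 'n \<Rightarrow> bool) \<Rightarrow> 'n set \<Rightarrow> bool" where
  "stable_set E S \<longleftrightarrow> (\<forall>u\<in>S. \<forall>v\<in>S. \<not> E u v)"

definition stability_number :: "('n::finite \<Rightarrow> 'n \<Rightarrow> bool) \<Rightarrow> nat" where
  "stability_number E = Max {card S | S. stable_set E S}"

definition incidence_vector :: "'n set \<Rightarrow> real ^ 'n" where
  "incidence_vector S = (\<chi> i. if i \<in> S then 1 else 0)"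

definition STAB :: "('n::finite \<Rightarrow> 'n \<Rightarrow> bool) \<Rightarrow> (real ^ 'n) set" where
  "STAB E = convex hull {incidence_vector S | S. stable_set E S}"

definition ESTAB :: "('n::finite \<Rightarrow> 'n \<Rightarrow> bool) \<Rightarrow> (real ^ 'n) set" where
  "ESTAB E = {x. (\<forall>i. 0 \<le> x $ i \<and> x $ i \<le> 1) \<and> (\<forall>i j. E i j \<longrightarrow> x $ i + x $ j \<le> 1)}"

definition facet_defining :: "('n::finite \<Rightarrow> 'n \<Rightarrow> bool) \<Rightarrow> bool" where
  "facet_defining E \<longleftrightarrow>
     (\<exists>(a :: real ^ 'n) (b :: real). (\<forall>i. a $ i \<noteq> 0) \<and> (\<forall>x\<in>STAB E. a \<bullet> x \<le> b) \<and>
        {x \<in> STAB E. a \<bullet> x = b} facet_of STAB E)"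

definition cone_of :: "(real ^ 'n) set \<Rightarrow> (real ^ ('n option)) set" where
  "cone_of K = {w. \<exists>y\<in>K. \<forall>j. w $ Some j = w $ None * y $ j}"

definition psd :: "real ^ 'm ^ 'm \<Rightarrow> bool" where
  "psd Y \<longleftrightarrow> transpose Y = Y \<and> (\<forall>z. 0 \<le> z \<bullet> (Y *v z))"

definition M_plus :: "(real ^ 'n::finite) set \<Rightarrow> (real ^ ('n option) ^ ('n option)) set" where
  "M_plus K = {Y. psd Y \<and>
      Y *v axis None 1 = (\<chi> k. Y $ k $ k) \<and>
      (\<forall>i. Y *v axis (Some i) 1 \<in> cone_of K) \<and>
      (\<forall>i. Y *v (axis None 1 - axis (Some i) 1) \<in> cone_of K)}"

definition LS_plus :: "(real ^ 'n::finite) set \<Rightarrow> (real ^ 'n) set" where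
  "LS_plus K = {x. (\<forall>i. 0 \<le> x $ i \<and> x $ i \<le> 1) \<and>
      (\<exists>Y\<in>M_plus K. Y *v axis None 1 = (\<chi> k. case k of None \<Rightarrow> 1 | Some i \<Rightarrow> x $ i))}"

definition LS_plus_perfect :: "('n::finite \<Rightarrow> 'n \<Rightarrow> bool) \<Rightarrow> bool" where
  "LS_plus_perfect E \<longleftrightarrow> LS_plus (ESTAB E) = STAB E"

definition odd_antihole_on :: "('n \<Rightarrow> 'n \<Rightarrow> bool) \<Rightarrow> 'n set \<Rightarrow> bool" where
  "odd_antihole_on E A \<longleftrightarrow>
     (\<exists>(n::nat) f. odd n \<and> 5 \<le> n \<and> bij_betw f A {0..<n} \<and>
        (\<forall>u\<in>A. \<forall>v\<in>A. E u v \<longleftrightarrow>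
            (u \<noteq> v \<and> (f u + 1) mod n \<noteq> f v \<and> (f v + 1) mod n \<noteq> f u)))"

definition is_clique :: "('n \<Rightarrow> 'n \<Rightarrow> bool) \<Rightarrow> 'n set \<Rightarrow> bool" where
  "is_clique E K \<longleftrightarrow> (\<forall>u\<in>K. \<forall>v\<in>K. u \<noteq> v \<longrightarrow> E u v)"

definition join_of_odd_antiholes_and_clique :: "('n \<Rightarrow> 'n \<Rightarrow> bool) \<Rightarrow> bool" where
  "join_of_odd_antiholes_and_clique E \<longleftrightarrow>
     (\<exists>P K. P \<noteq> {} \<and> finite P \<and>
        (\<forall>A\<in>P. \<forall>B\<in>P. A \<noteq> B \<longrightarrow> A \<inter> B = {}) \<and>
        (\<forall>A\<in>P. A \<inter> K = {}) \<and> \<Union>P \<union> K = UNIV \<and>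
        (\<forall>A\<in>P. odd_antihole_on E A) \<and> is_clique E K \<and>
        (\<forall>A\<in>P. \<forall>u\<in>A. \<forall>v. v \<notin> A \<longrightarrow> E u v))"

end

theory Submission
  imports Defs
begin

text \<open>
  Let \<open>H\<close> be the complement of \<open>G\<close>; it is triangle-free. A full-support facet is the only hyperplane
  through its tight stable sets. This forces \<open>H\<close> to be rigid: a function that changes sign
  along every edge of \<open>H\<close> vanishes on all non-isolated vertices (so no nontrivial component of \<open>H\<close>
  is bipartite), and the facet is \<open>a\<^sup>T x \<le> 2\<close> with \<open>a = 2\<close> on isolated vertices of \<open>H\<close> and \<open>a = 1\<close>
  elsewhere.

  Suppose a vertex \<open>u\<close> has three neighbours in \<open>H\<close>, one of them being \<open>v\<close>. The average \<open>Y\<close> of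
  \<open>(1, \<chi>\<^sub>S)(1, \<chi>\<^sub>S)\<^sup>T\<close> over all tight sets \<open>S\<close> has, by rigidity, the kernel spanned by \<open>(-2, a)\<close>. Adding
  a small multiple of the symmetric matrix that raises \<open>x\<^sub>v\<close> and \<open>X\<^sub>u\<^sub>v\<close> by 1 and lowers \<open>x\<^sub>u\<close> by \<open>1/2\<close>
  keeps it positive semidefinite, because this perturbation is positive on the kernel, and keeps
  all linear constraints of the operator, because none that becomes worse is tight. The resulting
  point of \<open>LS\<^sub>+(ESTAB)\<close> violates the facet. So \<open>LS\<^sub>+\<close>-perfection bounds the degrees in \<open>H\<close> by 2,
  and by rigidity every nontrivial component of \<open>H\<close> is an odd cycle, whose length is at least 5
  since \<open>H\<close> has no triangle.
\<close>


section \<open>Tight stable sets of a facet\<close>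

lemma inner_incidence_vector:
  fixes z :: "real ^ 'n::finite"
  shows "z \<bullet> incidence_vector S = (\<Sum>i\<in>S. z $ i)"
proof -
  have "z \<bullet> incidence_vector S = (\<Sum>i\<in>UNIV. if i \<in> S then z $ i else 0)"
    by (auto simp: inner_vec_def incidence_vector_def intro: sum.cong)
  then show ?thesis
    by (simp add: sum.If_cases)
qed

lemma incidence_vector_in_STAB: "stable_set E S \<Longrightarrow> incidence_vector S \<in> STAB E"
  unfolding STAB_def by (blast intro: hull_inc)

text \<open>Without loops the empty set and all singletons are stable, so \<open>STAB E\<close>
  contains the standard simplex.\<close>

lemma aff_dim_STAB:
  fixes E :: "'n::finite \<Rightarrow> 'n \<Rightarrow> bool"
  assumes "\<And>u. \<not> E u u"
  shows "aff_dim (STAB E) = CARD('n)"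
proof -
  have "x \<in> STAB E" if x: "x \<in> insert 0 (Basis :: (real ^ 'n) set)" for x
  proof -
    consider "x = 0" | i where "x = axis i 1"
      using x by (auto simp: Basis_vec_def)
    then obtain S where S: "x = incidence_vector S" "stable_set E S"
    proof cases
      case 1
      then show ?thesis
        by (intro that[of "{}"]) (auto simp: incidence_vector_def stable_set_def vec_eq_iff)
    next
      case (2 i)
      then show ?thesis using assms
        by (intro that[of "{i}"]) (auto simp: incidence_vector_def stable_set_def vec_eq_iff axis_def)
    qed
    then show ?thesis by (simp add: incidence_vector_in_STAB)
  qed
  then have "convex hull (insert 0 Basis) \<subseteq> STAB E"
    by (intro hull_minimal) (auto simp: STAB_def)
  then have "interior (STAB E) \<noteq> {}"
    using interior_std_simplex_nonempty interior_mono by (metis empty_iff subset_iff)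
  from aff_dim_nonempty_interior[OF this] show ?thesis by simp
qed

text \<open>A facet of a full-dimensional polytope has the dimension of its supporting hyperplane,
  so its tight vertices affinely span that hyperplane. An equation valid at these vertices is then
  valid on the whole hyperplane.\<close>

lemma facet_tight_sets_span:
  fixes E :: "'n::finite \<Rightarrow> 'n \<Rightarrow> bool"
  assumes irrefl: "\<And>u. \<not> E u u" and "a \<noteq> 0"
    and valid: "\<forall>x\<in>STAB E. a \<bullet> x \<le> b"
    and facet: "{x \<in> STAB E. a \<bullet> x = b} facet_of STAB E"
    and tight: "\<And>S. stable_set E S \<Longrightarrow> a \<bullet> incidence_vector S = b \<Longrightarrow> z \<bullet> incidence_vector S = d"
  obtains c where "z = c *\<^sub>R a" "d = c * b"
proof -
  define F where "F = {x \<in> STAB E. a \<bullet> x = b}"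
  define V where "V = {incidence_vector S | S. stable_set E S}"
  have "finite V"
    unfolding V_def by simp
  moreover have "F face_of convex hull V" "F \<noteq> {}" and adF: "aff_dim F = aff_dim (STAB E) - 1"
    using facet by (auto simp: facet_of_def F_def V_def STAB_def)
  ultimately obtain V' where V': "V' \<subseteq> V" "F = convex hull V'"
    using face_of_convex_hull_subset finite_imp_compact by metis
  have "V' \<subseteq> {x. z \<bullet> x = d}"
  proof
    fix x assume "x \<in> V'"
    then have "x \<in> V" "x \<in> F" using V' hull_inc by auto
    then show "x \<in> {x. z \<bullet> x = d}"
      using tight by (auto simp: V_def F_def)
  qed
  then have Fz: "F \<subseteq> {x. z \<bullet> x = d}"
    unfolding V' by (intro hull_minimal convex_hyperplane)
  define G where "G = {x. a \<bullet> x = b} \<inter> {x. z \<bullet> x = d}"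
  have aG: "affine G"
    unfolding G_def by (intro affine_Int affine_hyperplane)
  have FG: "F \<subseteq> G"
    using Fz by (auto simp: G_def F_def)
  have adH: "aff_dim {x. a \<bullet> x = b} = CARD('n) - 1"
    using aff_dim_hyperplane[OF \<open>a \<noteq> 0\<close>, of b] by simp
  have "aff_dim G = aff_dim {x. a \<bullet> x = b}"
  proof (rule antisym)
    show "aff_dim G \<le> aff_dim {x. a \<bullet> x = b}"
      by (rule aff_dim_subset) (simp add: G_def)
    show "aff_dim {x. a \<bullet> x = b} \<le> aff_dim G"
      using aff_dim_subset[OF FG] adF aff_dim_STAB[of E] irrefl adH by simp
  qed
  then have "G = {x. a \<bullet> x = b}"
    using aG affine_hyperplane FG \<open>F \<noteq> {}\<close> by (intro affine_dim_equal) (auto simp: G_def)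
  then have all: "z \<bullet> x = d" if "a \<bullet> x = b" for x
    using that by (auto simp: G_def)
  define c where "c = (z \<bullet> a) / (a \<bullet> a)"
  have aa: "a \<bullet> a \<noteq> 0" using \<open>a \<noteq> 0\<close> by simp
  \<comment> \<open>\<open>x0\<close> lies on the hyperplane and \<open>y\<close> is the part of
    \<open>z\<close> orthogonal to \<open>a\<close>. Moving from \<open>x0\<close> by
    \<open>y\<close> stays on the hyperplane, so \<open>z \<bullet> y = 0\<close> and hence
    \<open>y = 0\<close>.\<close>
  define x0 where "x0 = (b / (a \<bullet> a)) *\<^sub>R a"
  define y where "y = z - c *\<^sub>R a"
  have ay: "a \<bullet> y = 0"
    using aa by (simp add: y_def c_def inner_diff_right inner_commute)
  have "a \<bullet> x0 = b"
    using aa by (simp add: x0_def)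
  with ay have "a \<bullet> (x0 + y) = b"
    by (simp add: inner_add_right)
  then have "z \<bullet> (x0 + y) = d"
    by (rule all)
  moreover have "z \<bullet> x0 = d"
    using \<open>a \<bullet> x0 = b\<close> by (rule all)
  ultimately have "z \<bullet> y = 0" by (simp add: inner_add_right)
  then have "y \<bullet> y = 0"
    using ay by (simp add: y_def inner_diff_left inner_diff_right algebra_simps)
  then have z: "z = c *\<^sub>R a" by (simp add: y_def)
  moreover have "d = c * b"
    using \<open>z \<bullet> x0 = d\<close> aa by (auto simp: z x0_def)
  ultimately show thesis using that by blast
qed

section \<open>Rigidity of the complement\<close>

lemma stable_set_card_le_stability_number:
  fixes E :: "'n::finite \<Rightarrow> 'n \<Rightarrow> bool"
  shows "stable_set E S \<Longrightarrow> card S \<le> stability_number E"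
  unfolding stability_number_def by (intro Max_ge) auto

lemma stability_number_attained:
  fixes E :: "'n::finite \<Rightarrow> 'n \<Rightarrow> bool"
  obtains S where "stable_set E S" "card S = stability_number E"
proof -
  have "stable_set E {}" by (simp add: stable_set_def)
  then have "stability_number E \<in> {card S | S. stable_set E S}"
    unfolding stability_number_def by (intro Max_in) auto
  with that show thesis by auto
qed

text \<open>Adding \<open>f\<close> to the weights preserves the sum over every tight pair, and
  tight singletons can be left alone. Uniqueness of the facet equation leaves no room for such a
  change.\<close>

lemma facet_rigid:
  fixes E :: "'n::finite \<Rightarrow> 'n \<Rightarrow> bool" and f :: "'n \<Rightarrow> real"
  assumes sym: "\<And>u v. E u v \<Longrightarrow> E v u"
    and irrefl: "\<And>u. \<not> E u u"
    and alpha: "stability_number E = 2"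
    and facet: "facet_defining E"
    and f: "\<And>p q. p \<noteq> q \<Longrightarrow> \<not> E p q \<Longrightarrow> f p + f q = 0"
    and uv: "u \<noteq> v" "\<not> E u v"
  shows "f u = 0"
proof -
  obtain a b where full: "\<And>i. a $ i \<noteq> 0" and valid: "\<forall>x\<in>STAB E. a \<bullet> x \<le> b"
    and fac: "{x \<in> STAB E. a \<bullet> x = b} facet_of STAB E"
    using facet unfolding facet_defining_def by blast
  have a0: "a \<noteq> 0" using full by auto
  define T where "T = {S. stable_set E S \<and> (\<Sum>i\<in>S. a $ i) = b}"
  have span: "\<exists>c. z = c *\<^sub>R a \<and> d = c * b" if "\<And>S. S \<in> T \<Longrightarrow> (\<Sum>i\<in>S. z $ i) = d" for z d
    using facet_tight_sets_span[OF irrefl a0 valid fac, of z d] that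
    by (auto simp: T_def inner_incidence_vector)
  have val: "(\<Sum>i\<in>S. a $ i) \<le> b" if "stable_set E S" for S
    using valid incidence_vector_in_STAB[OF that] by (auto simp: inner_incidence_vector)
  have single: "stable_set E {i}" for i
    using irrefl by (simp add: stable_set_def)
  have b0: "0 \<le> b"
    using val[of "{}"] by (simp add: stable_set_def)
  \<comment> \<open>Dropping a vertex of negative weight from a tight set would exceed
    \<open>b\<close>, so no tight set contains it. Then \<open>axis i 1\<close> vanishes on all
    tight sets and is a multiple of \<open>a\<close>, which is nonzero at a second vertex.\<close>
  have pos: "0 < a $ i" for i
  proof (rule ccontr)
    assume "\<not> 0 < a $ i"
    with full[of i] have neg: "a $ i < 0" by simp
    have "i \<notin> S" if "S \<in> T" for S
    proof
      assume "i \<in> S"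
      then have "(\<Sum>j\<in>S. a $ j) = a $ i + (\<Sum>j\<in>S - {i}. a $ j)"
        by (simp add: sum.remove)
      moreover have "stable_set E (S - {i})"
        using that by (auto simp: T_def stable_set_def)
      ultimately show False
        using val neg that by (force simp: T_def)
    qed
    then have "(\<Sum>j\<in>S. axis i 1 $ j) = (0::real)" if "S \<in> T" for S
      using that by (intro sum.neutral) (auto simp: axis_def)
    then obtain c where c: "axis i 1 = c *\<^sub>R a" "0 = c * b"
      using span by blast
    obtain j where "j \<noteq> i"
      using uv by metis
    with c(1) have "c * a $ j = 0" "c * a $ i = 1"
      by (auto simp: vec_eq_iff axis_def split: if_splits)
    then show False using full[of j] by auto
  qed
  have "b > 0"
    using val[OF single[of u]] pos[of u] by simp
  \<comment> \<open>Adding a non-neighbour to a tight singleton would exceed \<open>b\<close>, as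
    weights are positive.\<close>
  have isol: "{p} \<notin> T" if "p \<noteq> q" "\<not> E p q" for p q
  proof
    assume "{p} \<in> T"
    moreover have "stable_set E {p, q}"
      using that sym irrefl by (auto simp: stable_set_def)
    ultimately show False
      using val[of "{p, q}"] pos[of q] that by (simp add: T_def)
  qed
  \<comment> \<open>\<open>z f\<close> and \<open>z 0\<close> both take the constant value 2 on all tight sets, hence are
    the same multiple of \<open>a\<close>.\<close>
  define z :: "('n \<Rightarrow> real) \<Rightarrow> real ^ 'n" where "z g = (\<chi> i. if {i} \<in> T then 2 else 1 + g i)" for g
  have z: "\<exists>c. z g = c *\<^sub>R a \<and> 2 = c * b"
    if g: "\<And>p q. p \<noteq> q \<Longrightarrow> \<not> E p q \<Longrightarrow> g p + g q = 0" for g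
  proof (rule span)
    fix S assume S: "S \<in> T"
    then have "card S \<le> 2"
      using stable_set_card_le_stability_number[of E S] alpha by (simp add: T_def)
    moreover have "S \<noteq> {}"
      using S \<open>b > 0\<close> by (auto simp: T_def)
    then have "card S \<noteq> 0" by simp
    ultimately consider "card S = 1" | "card S = 2" by linarith
    then show "(\<Sum>i\<in>S. z g $ i) = 2"
    proof cases
      case 1
      then obtain p where "S = {p}" by (rule card_1_singletonE)
      then show ?thesis using S by (simp add: z_def)
    next
      case 2
      then obtain p q where pq: "S = {p, q}" "p \<noteq> q" by (auto simp: card_2_iff)
      then have "\<not> E p q" "\<not> E q p"
        using S by (auto simp: T_def stable_set_def)
      then show ?thesis
        using isol[of p q] isol[of q p] g[of p q] pq by (simp add: z_def)
    qed
  qed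
  obtain c where c: "z f = c *\<^sub>R a" "2 = c * b" using z[of f] f by blast
  obtain c' where c': "z (\<lambda>_. 0) = c' *\<^sub>R a" "2 = c' * b" using z[of "\<lambda>_. 0"] by auto
  have "c = c'" using c c' \<open>b > 0\<close> by (metis less_irrefl mult_right_cancel)
  then have "z f $ u = z (\<lambda>_. 0) $ u" using c c' by simp
  then show ?thesis
    using isol[OF uv] by (simp add: z_def)
qed

section \<open>Small perturbations\<close>

lemma eventually_nonneg_perturb:
  fixes p q :: real
  assumes "0 \<le> p" "p = 0 \<Longrightarrow> 0 \<le> q"
  shows "\<forall>\<^sub>F e in at_right 0. 0 \<le> p + e * q"
proof (cases "p = 0")
  case True
  then show ?thesis
    using assms by (auto intro!: eventually_at_rightI[of 0 1])
next
  case False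
  have "((\<lambda>e. p + e * q) \<longlongrightarrow> p + 0 * q) (at_right 0)"
    by (intro tendsto_intros)
  then have "\<forall>\<^sub>F e in at_right 0. 0 < p + e * q"
    using False assms by (intro order_tendstoD(1)[of _ p]) auto
  then show ?thesis by eventually_elim simp
qed

text \<open>Only unit vectors with \<open>d x \<le> 0\<close> are critical. They form a compact set
  without zeros of \<open>q\<close>, so \<open>q\<close> has a positive minimum there that outweighs
  \<open>e * d\<close> for small \<open>e\<close>; homogeneity extends this to all vectors.\<close>

lemma eventually_psd_perturb:
  fixes q d :: "'a::euclidean_space \<Rightarrow> real"
  assumes cont: "continuous_on UNIV q" "continuous_on UNIV d"
    and hom: "\<And>c x. q (c *\<^sub>R x) = c\<^sup>2 * q x" "\<And>c x. d (c *\<^sub>R x) = c\<^sup>2 * d x"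
    and nonneg: "\<And>x. 0 \<le> q x"
    and ker: "\<And>x. x \<noteq> 0 \<Longrightarrow> q x = 0 \<Longrightarrow> 0 < d x"
  shows "\<forall>\<^sub>F e in at_right 0. \<forall>x. 0 \<le> q x + e * d x"
proof -
  define N where "N = {x. norm x = 1 \<and> d x \<le> 0}"
  have "N = sphere 0 1 \<inter> {x. d x \<le> 0}"
    by (auto simp: N_def)
  then have cN: "compact N"
    using cont by (auto intro!: compact_Int_closed closed_Collect_le continuous_intros)
  have "\<exists>e0>0. \<forall>e. 0 < e \<and> e < e0 \<longrightarrow> (\<forall>x\<in>N. 0 \<le> q x + e * d x)"
  proof (cases "N = {}")
    case True
    then show ?thesis by (auto intro: exI[of _ 1])
  next
    case False
    obtain y where y: "y \<in> N" "\<And>x. x \<in> N \<Longrightarrow> q y \<le> q x"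
      using continuous_attains_inf[OF cN False continuous_on_subset[OF cont(1)]] by auto
    obtain w where w: "w \<in> N" "\<And>x. x \<in> N \<Longrightarrow> d w \<le> d x"
      using continuous_attains_inf[OF cN False continuous_on_subset[OF cont(2)]] by auto
    have "0 < q y"
      using y ker[of y] nonneg[of y] by (force simp: N_def)
    \<comment> \<open>The summand 1 keeps the denominator positive when
      \<open>d w = 0\<close>.\<close>
    define e0 where "e0 = q y / (1 - d w)"
    have dw: "d w \<le> 0" using w by (simp add: N_def)
    have "0 \<le> q x + e * d x" if "0 < e" "e < e0" "x \<in> N" for e x
    proof -
      have "e * (1 - d w) < q y"
        using that dw by (simp add: e0_def pos_less_divide_eq)
      moreover have "e * d w \<le> e * d x"
        using w that by (intro mult_left_mono) auto
      ultimately show ?thesis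
        using y(2)[OF that(3)] that(1) unfolding right_diff_distrib by linarith
    qed
    moreover have "0 < e0"
      using \<open>0 < q y\<close> dw by (simp add: e0_def)
    ultimately show ?thesis by blast
  qed
  then obtain e0 where e0: "0 < e0"
    "\<And>e x. 0 < e \<Longrightarrow> e < e0 \<Longrightarrow> x \<in> N \<Longrightarrow> 0 \<le> q x + e * d x" by blast
  show ?thesis
  proof (rule eventually_at_rightI[OF _ e0(1)], intro allI)
    fix e x assume e: "e \<in> {0<..<e0}"
    show "0 \<le> q x + e * d x"
    proof (cases "x = 0")
      case True
      then show ?thesis using hom[of 0 x] by simp
    next
      case False
      define y where "y = x /\<^sub>R norm x"
      have x: "x = norm x *\<^sub>R y" and "norm y = 1"
        using False by (auto simp: y_def)
      have "0 \<le> q y + e * d y"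
      proof (cases "y \<in> N")
        case True
        then show ?thesis using e0 e by auto
      next
        case False
        then show ?thesis using nonneg[of y] \<open>norm y = 1\<close> e by (auto simp: N_def)
      qed
      then have "0 \<le> (norm x)\<^sup>2 * (q y + e * d y)" by simp
      also have "\<dots> = q (norm x *\<^sub>R y) + e * d (norm x *\<^sub>R y)"
        by (simp only: hom) (simp add: algebra_simps)
      finally show ?thesis using x by simp
    qed
  qed
qed

section \<open>Membership in \<open>LS_plus (ESTAB E)\<close>\<close>

lemma cone_of_ESTAB_I:
  fixes w :: "real ^ ('n::finite option)"
  assumes "\<And>j. 0 \<le> w $ Some j" "\<And>j. w $ Some j \<le> w $ None"
    and "\<And>j k. E j k \<Longrightarrow> w $ Some j + w $ Some k \<le> w $ None"
  shows "w \<in> cone_of (ESTAB E)"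
proof (cases "w $ None = 0")
  case True
  then have "w $ Some j = 0" for j
    using assms(1,2)[of j] by simp
  then show ?thesis
    using True unfolding cone_of_def ESTAB_def by (auto intro!: exI[of _ 0])
next
  case False
  then have pos: "0 < w $ None"
    using order_trans[OF assms(1,2)] by (simp add: less_le)
  show ?thesis
    unfolding cone_of_def ESTAB_def mem_Collect_eq
    by (intro bexI[of _ "\<chi> j. w $ Some j / w $ None"])
      (use assms pos in \<open>auto simp: add_divide_distrib[symmetric]\<close>)
qed

text \<open>\<open>W\<close> is unnormalised, so that a plain sum over stable sets can be used.
  \<open>nonneg\<close>, \<open>le\<close> and \<open>edge\<close> put column \<open>i\<close> into
  the cone; \<open>le\<close> with swapped indices, \<open>le'\<close> and \<open>edge'\<close> do
  so for column 0 minus column \<open>i\<close>.\<close>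

lemma LS_plus_ESTAB_I:
  fixes W :: "'n::finite option \<Rightarrow> 'n option \<Rightarrow> real"
  assumes sym: "\<And>k l. W k l = W l k" and pos: "0 < W None None"
    and diag: "\<And>i. W (Some i) (Some i) = W None (Some i)"
    and psd: "\<And>z :: real ^ 'n option. 0 \<le> (\<Sum>k\<in>UNIV. \<Sum>l\<in>UNIV. z $ k * W k l * z $ l)"
    and nonneg: "\<And>i j. 0 \<le> W (Some i) (Some j)"
    and le: "\<And>i j. W (Some i) (Some j) \<le> W None (Some i)"
    and edge: "\<And>i j k. E j k \<Longrightarrow> W (Some i) (Some j) + W (Some i) (Some k) \<le> W None (Some i)"
    and le': "\<And>i j. W None (Some i) + W None (Some j) \<le> W None None + W (Some i) (Some j)"
    and edge': "\<And>i j k. E j k \<Longrightarrow> W None (Some i) + W None (Some j) + W None (Some k)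
      \<le> W None None + W (Some i) (Some j) + W (Some i) (Some k)"
  shows "(\<chi> i. W None (Some i) / W None None) \<in> LS_plus (ESTAB E)"
proof -
  define m where "m = W None None"
  define Y :: "real ^ ('n option) ^ ('n option)" where "Y = (\<chi> k l. W k l / m)"
  have m: "0 < m" using pos by (simp add: m_def)
  have col: "Y *v axis l 1 = (\<chi> k. W l k / m)" for l
    by (simp add: matrix_vector_mult_basis column_def Y_def sym[of l])
  have "psd Y"
    unfolding psd_def
  proof (intro conjI allI)
    show "transpose Y = Y"
      using sym by (simp add: Y_def transpose_def vec_eq_iff)
    fix z :: "real ^ 'n option"
    have "z \<bullet> (Y *v z) = (\<Sum>k\<in>UNIV. \<Sum>l\<in>UNIV. z $ k * W k l * z $ l) / m"
      by (simp add: inner_vec_def matrix_vector_mult_def Y_def sum_distrib_left sum_divide_distrib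
          mult.assoc)
    then show "0 \<le> z \<bullet> (Y *v z)"
      using psd m by simp
  qed
  moreover have "Y *v axis None 1 = (\<chi> k. Y $ k $ k)"
  proof -
    have "W None k / m = W k k / m" for k
      using diag by (cases k) auto
    then show ?thesis unfolding col by (simp only: Y_def vec_lambda_beta)
  qed
  moreover have "Y *v axis (Some i) 1 \<in> cone_of (ESTAB E)" for i
    unfolding col
    using nonneg le edge m
    by (intro cone_of_ESTAB_I)
      (auto simp: add_divide_distrib[symmetric] divide_right_mono sym[of "Some i" None])
  moreover have "Y *v (axis None 1 - axis (Some i) 1) \<in> cone_of (ESTAB E)" for i
  proof -
    have "Y *v (axis None 1 - axis (Some i) 1) = (\<chi> k. (W None k - W (Some i) k) / m)"
      unfolding matrix_vector_mult_diff_distrib col by (simp add: vec_eq_iff diff_divide_distrib)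
    also have "\<dots> \<in> cone_of (ESTAB E)"
    proof (rule cone_of_ESTAB_I)
      fix j
      show "0 \<le> (\<chi> k. (W None k - W (Some i) k) / m) $ Some j"
        using le[of j i] m sym[of "Some i" "Some j"] by simp
      show "(\<chi> k. (W None k - W (Some i) k) / m) $ Some j \<le> (\<chi> k. (W None k - W (Some i) k) / m) $ None"
        using le'[of i j] m sym[of "Some i" None] by (simp add: divide_right_mono)
    next
      fix j k assume "E j k"
      from edge'[OF this, of i]
      show "(\<chi> k. (W None k - W (Some i) k) / m) $ Some j + (\<chi> k. (W None k - W (Some i) k) / m) $ Some k
          \<le> (\<chi> k. (W None k - W (Some i) k) / m) $ None"
        using m sym[of "Some i" None]
        by (simp add: add_divide_distrib[symmetric] divide_right_mono)
    qed
    finally show ?thesis .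
  qed
  ultimately have "Y \<in> M_plus (ESTAB E)"
    by (simp add: M_plus_def)
  moreover have "Y *v axis None 1
      = (\<chi> k. case k of None \<Rightarrow> 1 | Some i \<Rightarrow> (\<chi> i. W None (Some i) / m) $ i)"
    unfolding col using m by (auto simp: vec_eq_iff m_def split: option.splits)
  moreover have "0 \<le> W None (Some i) / m" "W None (Some i) / m \<le> 1" for i
    using nonneg[of i i] le'[of i i] m diag[of i] by (auto simp: m_def)
  ultimately show ?thesis
    unfolding LS_plus_def m_def[symmetric] by auto
qed

section \<open>The degree bound in the complement\<close>

lemma degree_le_two_if_LS_plus_perfect:
  fixes E :: "'n::finite \<Rightarrow> 'n \<Rightarrow> bool"
  defines "h \<equiv> \<lambda>u v. u \<noteq> v \<and> \<not> E u v"
  assumes sym: "\<And>u v. E u v \<Longrightarrow> E v u"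
    and irrefl: "\<And>u. \<not> E u u"
    and card: "\<And>S. stable_set E S \<Longrightarrow> card S \<le> 2"
    and rigid: "\<And>(f :: 'n \<Rightarrow> real) u v. (\<And>p q. h p q \<Longrightarrow> f p + f q = 0) \<Longrightarrow> h u v \<Longrightarrow> f u = 0"
    and lsp: "LS_plus_perfect E"
    and nbrs: "h u v" "h u s" "h u t"
  shows "v = s \<or> v = t \<or> s = t"
proof (rule ccontr)
  assume "\<not> ?thesis"
  then have dist: "v \<noteq> s" "v \<noteq> t" "s \<noteq> t" by auto
  have hsym: "h q p" if "h p q" for p q
    using that sym by (auto simp: h_def)
  have huv: "u \<noteq> v" "\<not> E u v" "\<not> E v u" "v \<noteq> u"
    using nbrs(1) sym by (auto simp: h_def)
  define iso where "iso p \<longleftrightarrow> (\<forall>q. \<not> h p q)" for p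
  \<comment> \<open>\<open>F\<close> consists of the stable sets of weight exactly 2 when isolated
    vertices of \<open>h\<close> weigh 2 and all others 1.\<close>
  define F where "F = {{p, q} | p q. h p q} \<union> {{p} | p. iso p}"
  have F_edge: "{p, q} \<in> F" if "h p q" for p q
    using that by (auto simp: F_def)
  have F_stable: "j \<notin> S \<or> k \<notin> S" if "S \<in> F" "E j k" for S j k
    using that irrefl sym by (auto simp: F_def h_def)
  have no_triangle: "\<not> h p q" if "h u p" "h u q" for p q
  proof
    assume "h p q"
    with that have "stable_set E {u, p, q}" "card {u, p, q} = 3"
      using sym irrefl by (auto simp: stable_set_def h_def)
    then show False using card by fastforce
  qed

  define ind :: "'n set \<Rightarrow> 'n option \<Rightarrow> real"
    where "ind S k = (case k of None \<Rightarrow> 1 | Some i \<Rightarrow> if i \<in> S then 1 else 0)" for S k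
  have [simp]: "ind S None = 1" for S
    by (simp add: ind_def)
  have ind_Some: "ind S (Some i) = (if i \<in> S then 1 else 0)" for S i
    by (simp add: ind_def)
  define N where "N k l = (\<Sum>S\<in>F. ind S k * ind S l)" for k l
  define \<delta> :: "'n option \<Rightarrow> 'n option \<Rightarrow> real" where "\<delta> a k = (if k = a then 1 else 0)" for a k
  \<comment> \<open>At the kernel vector \<open>(-2, 1, ..., 1)\<close> of \<open>N\<close> the form \<open>D\<close> has the value \<open>1/2\<close>, and the
    diagonal of \<open>D\<close> has total weight \<open>1 - 1/2 > 0\<close>. Raising \<open>x\<^sub>v\<close> together with \<open>X\<^sub>u\<^sub>v\<close> respects the
    constraints tight at \<open>v\<close>; those at \<open>u\<close> are slack because \<open>u\<close> has a third neighbour.\<close>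
  define D where "D k l =
      \<delta> None k * \<delta> (Some v) l + \<delta> (Some v) k * \<delta> None l + \<delta> (Some v) k * \<delta> (Some v) l
      + \<delta> (Some u) k * \<delta> (Some v) l + \<delta> (Some v) k * \<delta> (Some u) l
      - (\<delta> None k * \<delta> (Some u) l + \<delta> (Some u) k * \<delta> None l + \<delta> (Some u) k * \<delta> (Some u) l) / 2"
    for k l
  define W where "W e k l = N k l + e * D k l" for e k l
  have [simp]: "D None None = 0"
    by (simp add: D_def \<delta>_def)
  have D [simp]: "D None (Some i) = (if i = v then 1 else if i = u then - 1 / 2 else 0)"
    "D (Some i) (Some j) =
      (if i = v \<and> j = v \<or> i = u \<and> j = v \<or> i = v \<and> j = u then 1
       else if i = u \<and> j = u then - 1 / 2 else 0)" for i j
    using huv by (auto simp: D_def \<delta>_def)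
  have eventually_imp: "\<forall>\<^sub>F e in G. A \<longrightarrow> P e" if "A \<Longrightarrow> \<forall>\<^sub>F e in G. P e"
    for A P and G :: "real filter"
    using that by (cases A) auto
  define q :: "real ^ 'n option \<Rightarrow> real" where "q z = (\<Sum>S\<in>F. (\<Sum>k\<in>UNIV. ind S k * z $ k)\<^sup>2)" for z
  define d :: "real ^ 'n option \<Rightarrow> real" where "d z =
      2 * z $ None * z $ Some v + (z $ Some v)\<^sup>2 + 2 * z $ Some u * z $ Some v
      - z $ None * z $ Some u - (z $ Some u)\<^sup>2 / 2" for z
  have option_sum: "(\<Sum>k\<in>UNIV. g k) = g None + (\<Sum>i\<in>UNIV. g (Some i))" for g :: "'n option \<Rightarrow> real"
    by (simp add: UNIV_option_conv sum.reindex)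
  have ind_sum: "(\<Sum>i\<in>UNIV. ind S (Some i) * g i) = (\<Sum>i\<in>S. g i)" for S :: "'n set" and g :: "'n \<Rightarrow> real"
  proof -
    have "(\<Sum>i\<in>UNIV. ind S (Some i) * g i) = (\<Sum>i\<in>UNIV. if i \<in> S then g i else 0)"
      by (intro sum.cong) (auto simp: ind_Some)
    then show ?thesis by (simp add: sum.If_cases)
  qed
  have quad: "(\<Sum>k\<in>UNIV. \<Sum>l\<in>UNIV. z $ k * W e k l * z $ l) = q z + e * d z" for z e
  proof -
    have "(\<Sum>k\<in>UNIV. \<Sum>l\<in>UNIV. z $ k * N k l * z $ l)
        = (\<Sum>k\<in>UNIV. \<Sum>l\<in>UNIV. \<Sum>S\<in>F. (ind S k * z $ k) * (ind S l * z $ l))"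
      by (simp add: N_def sum_distrib_left sum_distrib_right mult_ac)
    also have "\<dots> = (\<Sum>S\<in>F. \<Sum>k\<in>UNIV. \<Sum>l\<in>UNIV. (ind S k * z $ k) * (ind S l * z $ l))"
      by (simp only: sum.swap[of _ F UNIV])
    also have "\<dots> = q z"
      by (simp add: q_def power2_eq_square sum_product)
    finally have qN: "(\<Sum>k\<in>UNIV. \<Sum>l\<in>UNIV. z $ k * N k l * z $ l) = q z" .
    \<comment> \<open>With the coordinates absorbed into the indicators, each double sum factors
      into two single sums, each a coordinate of \<open>z\<close>.\<close>
    define \<zeta> where "\<zeta> a k = \<delta> a k * z $ k" for a k
    have \<zeta>: "(\<Sum>k\<in>UNIV. \<zeta> a k) = z $ a" for a
    proof -
      have "(\<Sum>k\<in>UNIV. \<zeta> a k) = (\<Sum>k\<in>UNIV. if k = a then z $ k else 0)"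
        by (intro sum.cong) (auto simp: \<zeta>_def \<delta>_def)
      then show ?thesis by simp
    qed
    have "(\<Sum>k\<in>UNIV. \<Sum>l\<in>UNIV. z $ k * D k l * z $ l)
      = (\<Sum>k\<in>UNIV. \<Sum>l\<in>UNIV.
          \<zeta> None k * \<zeta> (Some v) l + \<zeta> (Some v) k * \<zeta> None l + \<zeta> (Some v) k * \<zeta> (Some v) l
          + \<zeta> (Some u) k * \<zeta> (Some v) l + \<zeta> (Some v) k * \<zeta> (Some u) l
          - (\<zeta> None k * \<zeta> (Some u) l + \<zeta> (Some u) k * \<zeta> None l + \<zeta> (Some u) k * \<zeta> (Some u) l) / 2)"
      by (intro sum.cong refl) (simp add: D_def \<zeta>_def field_simps)
    also have "\<dots> = d z"
      by (simp only: sum.distrib sum_subtractf sum_product[symmetric] sum_divide_distrib[symmetric] \<zeta>)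
        (simp add: d_def power2_eq_square field_simps)
    finally have dD: "(\<Sum>k\<in>UNIV. \<Sum>l\<in>UNIV. z $ k * D k l * z $ l) = d z" .
    have "(\<Sum>k\<in>UNIV. \<Sum>l\<in>UNIV. z $ k * W e k l * z $ l)
        = (\<Sum>k\<in>UNIV. \<Sum>l\<in>UNIV. z $ k * N k l * z $ l + e * (z $ k * D k l * z $ l))"
      by (intro sum.cong refl) (simp add: W_def algebra_simps)
    also have "\<dots> = q z + e * d z"
      by (simp only: sum.distrib sum_distrib_left[symmetric] qN dD)
    finally show ?thesis .
  qed

  \<comment> \<open>Positive semidefiniteness of the perturbed matrix\<close>
  have ker: "0 < d z" if "z \<noteq> 0" "q z = 0" for z
  proof -
    have S0: "z $ None + (\<Sum>i\<in>S. z $ Some i) = 0" if "S \<in> F" for S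
    proof -
      have "(\<Sum>k\<in>UNIV. ind S k * z $ k)\<^sup>2 = 0"
        using \<open>q z = 0\<close> that by (simp add: q_def sum_nonneg_eq_0_iff)
      then show ?thesis by (simp add: option_sum ind_sum)
    qed
    \<comment> \<open>Shifted by \<open>z $ None / 2\<close>, the equations of the pairs in
      \<open>F\<close> describe a function alternating along \<open>h\<close>, which rigidity makes
      zero.\<close>
    have half: "z $ Some p = - z $ None / 2" if "h p p'" for p p'
    proof -
      have "z $ Some a + z $ None / 2 + (z $ Some b + z $ None / 2) = 0" if "h a b" for a b
        using S0[OF F_edge[OF that]] that by (simp add: h_def)
      from rigid[of "\<lambda>a. z $ Some a + z $ None / 2", OF this that] show ?thesis by simp
    qed
    have z0: "z $ None \<noteq> 0"
    proof
      assume z0: "z $ None = 0"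
      have "z $ Some p = 0" for p
      proof (cases "iso p")
        case True
        then show ?thesis using S0[of "{p}"] z0 by (auto simp: F_def)
      next
        case False
        then show ?thesis using half z0 by (auto simp: iso_def)
      qed
      with z0 have "z $ k = 0" for k by (cases k) auto
      then show False using \<open>z \<noteq> 0\<close> by (simp add: vec_eq_iff)
    qed
    have "d z = (z $ None)\<^sup>2 / 8"
      unfolding d_def half[OF nbrs(1)] half[OF hsym[OF nbrs(1)]]
      by (simp add: power2_eq_square field_simps)
    then show ?thesis using z0 by (simp only:) simp
  qed
  have psd: "\<forall>\<^sub>F e in at_right 0. \<forall>z. 0 \<le> q z + e * d z"
  proof (rule eventually_psd_perturb[OF _ _ _ _ _ ker])
    show "continuous_on UNIV q" "continuous_on UNIV d"
      unfolding q_def d_def by (intro continuous_intros; simp)+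
    show "q (c *\<^sub>R z) = c\<^sup>2 * q z" for c z
      by (simp add: q_def sum_distrib_left power_mult_distrib[symmetric] mult_ac)
    show "d (c *\<^sub>R z) = c\<^sup>2 * d z" for c z
      by (simp add: d_def power2_eq_square algebra_simps)
    show "0 \<le> q z" for z by (simp add: q_def sum_nonneg)
  qed

  \<comment> \<open>Linear constraints of the perturbed matrix\<close>
  \<comment> \<open>Each slack is a sum of nonnegative contributions of the sets in
    \<open>F\<close>. One positive contribution already absorbs a small perturbation, so the sign of
    \<open>c\<close> matters only if all vanish.\<close>
  have perturb: "\<forall>\<^sub>F e in at_right 0. 0 \<le> (\<Sum>S\<in>F. g S) + e * c"
    if "\<And>S. S \<in> F \<Longrightarrow> 0 \<le> g S" "(\<And>S. S \<in> F \<Longrightarrow> g S = 0) \<Longrightarrow> 0 \<le> c"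
    for g :: "'n set \<Rightarrow> real" and c
    by (rule eventually_nonneg_perturb) (use that in \<open>simp_all add: sum_nonneg sum_nonneg_eq_0_iff\<close>)
  \<comment> \<open>Here the degree of \<open>u\<close> enters: some neighbour of \<open>u\<close>
    avoids any two given vertices, and its pair with \<open>u\<close> lies in
    \<open>F\<close>.\<close>
  have third: "\<exists>w. h u w \<and> w \<noteq> j \<and> w \<noteq> k" for j k
    using nbrs dist by metis
  note ind_Some [simp]
  have nonneg: "\<forall>\<^sub>F e in at_right 0. 0 \<le> W e (Some i) (Some j)" for i j
    unfolding W_def N_def
  proof (rule perturb)
    assume "\<And>S. S \<in> F \<Longrightarrow> ind S (Some i) * ind S (Some j) = 0"
    \<comment> \<open>The only negative entry in question is at \<open>u\<close>, \<open>u\<close>,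
      where the pair \<open>{u, v}\<close> gives slack.\<close>
    from this[OF F_edge[OF nbrs(1)]] show "0 \<le> D (Some i) (Some j)" by (auto split: if_splits)
  qed simp
  have le: "\<forall>\<^sub>F e in at_right 0. W e (Some i) (Some j) \<le> W e None (Some i)" for i j
  proof -
    have "\<forall>\<^sub>F e in at_right 0. 0 \<le> (\<Sum>S\<in>F. ind S (Some i) * (1 - ind S (Some j)))
        + e * (D None (Some i) - D (Some i) (Some j))"
    proof (rule perturb)
      assume *: "\<And>S. S \<in> F \<Longrightarrow> ind S (Some i) * (1 - ind S (Some j)) = 0"
      obtain w where "h u w" "w \<noteq> j" using third by metis
      \<comment> \<open>At \<open>i = j = u\<close> the two changes cancel; at \<open>i = v\<close>
        the rise of the entry \<open>None\<close>, \<open>v\<close> covers that of any entry in row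
        \<open>v\<close>.\<close>
      with *[OF F_edge[of u w]] have "i = u \<Longrightarrow> j = u" by (auto split: if_splits)
      then show "0 \<le> D None (Some i) - D (Some i) (Some j)"
        using huv by auto
    qed auto
    then show ?thesis
      by eventually_elim
        (simp add: W_def N_def algebra_simps sum_subtractf sum.distrib del: D ind_Some)
  qed
  have edge: "\<forall>\<^sub>F e in at_right 0. W e (Some i) (Some j) + W e (Some i) (Some k) \<le> W e None (Some i)"
    if "E j k" for i j k
  proof -
    have "\<forall>\<^sub>F e in at_right 0. 0 \<le> (\<Sum>S\<in>F. ind S (Some i) * (1 - ind S (Some j) - ind S (Some k)))
        + e * (D None (Some i) - D (Some i) (Some j) - D (Some i) (Some k))"
    proof (rule perturb)
      assume *: "\<And>S. S \<in> F \<Longrightarrow> ind S (Some i) * (1 - ind S (Some j) - ind S (Some k)) = 0"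
      obtain w where "h u w" "w \<noteq> j" "w \<noteq> k" using third by metis
      \<comment> \<open>Since \<open>u\<close> and \<open>v\<close> are non-adjacent, at most one of
        \<open>j\<close>, \<open>k\<close> is among them, so at most one of the two entries changes
        in rows \<open>u\<close> and \<open>v\<close>.\<close>
      with *[OF F_edge[of u w]] have "i = u \<Longrightarrow> j = u \<or> k = u" by (auto split: if_splits)
      then show "0 \<le> D None (Some i) - D (Some i) (Some j) - D (Some i) (Some k)"
        using huv that irrefl by auto
    qed (use F_stable[OF _ that] in auto)
    then show ?thesis
      by eventually_elim
        (simp add: W_def N_def algebra_simps sum_subtractf sum.distrib del: D ind_Some)
  qed
  have le': "\<forall>\<^sub>F e in at_right 0. W e None (Some i) + W e None (Some j)
      \<le> W e None None + W e (Some i) (Some j)" for i j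
  proof -
    have "\<forall>\<^sub>F e in at_right 0. 0 \<le> (\<Sum>S\<in>F. (1 - ind S (Some i)) * (1 - ind S (Some j)))
        + e * (D (Some i) (Some j) - D None (Some i) - D None (Some j))"
    proof (rule perturb)
      assume *: "\<And>S. S \<in> F \<Longrightarrow> (1 - ind S (Some i)) * (1 - ind S (Some j)) = 0"
      obtain w where "h u w" "w \<noteq> i" "w \<noteq> j" using third by metis
      \<comment> \<open>Otherwise \<open>{u, w}\<close> would miss \<open>i\<close> and
        \<open>j\<close>. With \<open>u\<close> present the change is 1/2, as a rise at
        \<open>v\<close> is met by the rise of the entry \<open>u\<close>, \<open>v\<close>.\<close>
      with *[OF F_edge[of u w]] have "i = u \<or> j = u" by (auto split: if_splits)
      then show "0 \<le> D (Some i) (Some j) - D None (Some i) - D None (Some j)"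
        using huv by auto
    qed auto
    then show ?thesis
      by eventually_elim
        (simp add: W_def N_def algebra_simps sum_subtractf sum.distrib del: D ind_Some)
  qed
  have edge': "\<forall>\<^sub>F e in at_right 0. W e None (Some i) + W e None (Some j) + W e None (Some k)
      \<le> W e None None + W e (Some i) (Some j) + W e (Some i) (Some k)"
    if "E j k" for i j k
  proof -
    have "\<forall>\<^sub>F e in at_right 0. 0 \<le> (\<Sum>S\<in>F. (1 - ind S (Some i)) * (1 - ind S (Some j) - ind S (Some k)))
        + e * (D (Some i) (Some j) + D (Some i) (Some k)
          - D None (Some i) - D None (Some j) - D None (Some k))"
    proof (rule perturb)
      assume *: "\<And>S. S \<in> F \<Longrightarrow> (1 - ind S (Some i)) * (1 - ind S (Some j) - ind S (Some k)) = 0"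
      define X where "X = {i, j, k}"
      \<comment> \<open>A pair missing \<open>X\<close> would contribute 1, so tightness makes
        \<open>X\<close> a vertex cover of \<open>h\<close>.\<close>
      have hit: "p \<in> X \<or> p' \<in> X" if "h p p'" for p p'
        using *[OF F_edge[OF that]] by (auto simp: X_def split: if_splits)
      \<comment> \<open>Otherwise \<open>X\<close> is the independent neighbourhood of \<open>u\<close> and also a vertex cover of \<open>h\<close>, so that
        \<open>h\<close> is bipartite, contradicting rigidity.\<close>
      have "u \<in> X"
      proof (rule ccontr)
        assume uX: "u \<notin> X"
        then have "{v, s, t} \<subseteq> X"
          using hit nbrs by blast
        moreover have "card {v, s, t} = 3" using dist by simp
        moreover have "card X \<le> 3"
          unfolding X_def by (metis card_3_iff card_length length_Cons list.set(1,2) list.size(3) numeral_3_eq_3)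
        ultimately have X: "X = {v, s, t}"
          by (metis card_seteq finite.emptyI finite_insert X_def)
        then have uX': "h u p" if "p \<in> X" for p
          using that nbrs by auto
        define f :: "'n \<Rightarrow> real" where "f p = (if p \<in> X then 1 else - 1)" for p
        have "f p + f p' = 0" if "h p p'" for p p'
          using hit[OF that] no_triangle uX' that by (auto simp: f_def)
        from rigid[of f, OF this nbrs(1)] show False
          using uX by (simp add: f_def)
      qed
      then show "0 \<le> D (Some i) (Some j) + D (Some i) (Some k)
          - D None (Some i) - D None (Some j) - D None (Some k)"
        using huv that irrefl by (auto simp: X_def)
    qed (use F_stable[OF _ that] in auto)
    then show ?thesis
      by eventually_elim
        (simp add: W_def N_def algebra_simps sum_subtractf sum.distrib del: D ind_Some)
  qed

  \<comment> \<open>The violated inequality\<close>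
  have "\<forall>\<^sub>F e in at_right 0. 0 < e \<and> (\<forall>z. 0 \<le> q z + e * d z)
      \<and> (\<forall>i j. 0 \<le> W e (Some i) (Some j))
      \<and> (\<forall>i j. W e (Some i) (Some j) \<le> W e None (Some i))
      \<and> (\<forall>i j. W e None (Some i) + W e None (Some j) \<le> W e None None + W e (Some i) (Some j))
      \<and> (\<forall>i j k. E j k \<longrightarrow> W e (Some i) (Some j) + W e (Some i) (Some k) \<le> W e None (Some i))
      \<and> (\<forall>i j k. E j k \<longrightarrow> W e None (Some i) + W e None (Some j) + W e None (Some k)
          \<le> W e None None + W e (Some i) (Some j) + W e (Some i) (Some k))"
    by (intro eventually_conj eventually_all_finite eventually_at_right_less psd nonneg le le'
        eventually_imp edge edge')
  from eventually_happens'[OF trivial_limit_at_right_real this]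
  obtain e where e: "0 < e" and ineqs: "\<forall>z. 0 \<le> q z + e * d z"
      "\<forall>i j. 0 \<le> W e (Some i) (Some j)"
      "\<forall>i j. W e (Some i) (Some j) \<le> W e None (Some i)"
      "\<forall>i j. W e None (Some i) + W e None (Some j) \<le> W e None None + W e (Some i) (Some j)"
      "\<forall>i j k. E j k \<longrightarrow> W e (Some i) (Some j) + W e (Some i) (Some k) \<le> W e None (Some i)"
      "\<forall>i j k. E j k \<longrightarrow> W e None (Some i) + W e None (Some j) + W e None (Some k)
          \<le> W e None None + W e (Some i) (Some j) + W e (Some i) (Some k)"
    by (elim exE conjE) (rule that)
  define m where "m = W e None None"
  have m: "m = card F" by (simp add: m_def W_def N_def)
  have "F \<noteq> {}" using F_edge nbrs by blast
  then have "0 < m" by (simp add: m card_gt_0_iff)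
  define x :: "real ^ 'n" where "x = (\<chi> i. W e None (Some i) / m)"
  have "x \<in> LS_plus (ESTAB E)"
    unfolding x_def m_def
  proof (rule LS_plus_ESTAB_I)
    show "W e k l = W e l k" for k l
      by (simp add: W_def N_def D_def mult.commute)
    show "W e (Some i) (Some i) = W e None (Some i)" for i
      using huv by (auto simp: W_def N_def intro!: sum.cong)
    show "0 < W e None None" using \<open>0 < m\<close> by (simp add: m_def)
  qed (use ineqs quad in auto)
  then have "x \<in> STAB E"
    using lsp by (simp add: LS_plus_perfect_def)
  \<comment> \<open>Validity of \<open>a \<bullet> x \<le> 2\<close> is immediate: a stable set with
    an isolated vertex of \<open>h\<close> is a singleton, and any other has at most two vertices of
    weight 1.\<close>
  define a :: "real ^ 'n" where "a = (\<chi> i. if iso i then 2 else 1)"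
  have "(\<Sum>i\<in>S. a $ i) \<le> 2" if S: "stable_set E S" for S
  proof (cases "\<exists>p\<in>S. iso p")
    case True
    then obtain p where "p \<in> S" "iso p" by blast
    moreover have "S = {p}"
      using \<open>p \<in> S\<close> \<open>iso p\<close> S by (auto simp: iso_def h_def stable_set_def)
    ultimately show ?thesis by (simp add: a_def)
  next
    case False
    then have "(\<Sum>i\<in>S. a $ i) = (\<Sum>i\<in>S. 1)"
      by (intro sum.cong) (auto simp: a_def)
    then show ?thesis using card[OF S] by simp
  qed
  then have "STAB E \<subseteq> {x. a \<bullet> x \<le> 2}"
    unfolding STAB_def
    by (intro hull_minimal convex_halfspace_le) (auto simp: inner_incidence_vector)
  with \<open>x \<in> STAB E\<close> have "a \<bullet> x \<le> 2" by blast
  moreover have "a \<bullet> x = (\<Sum>i\<in>UNIV. W e None (Some i) * a $ i) / m"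
    by (simp add: inner_vec_def x_def sum_divide_distrib mult.commute)
  \<comment> \<open>Each set in \<open>F\<close> contributes 2, and \<open>D\<close> adds 1 at
    \<open>v\<close> and -1/2 at \<open>u\<close>, both of weight 1. Division by \<open>m\<close>
    gives a value above 2.\<close>
  moreover have "(\<Sum>i\<in>UNIV. W e None (Some i) * a $ i) = 2 * m + e / 2"
  proof -
    have "(\<Sum>i\<in>UNIV. N None (Some i) * a $ i) = (\<Sum>S\<in>F. \<Sum>i\<in>UNIV. ind S (Some i) * a $ i)"
      unfolding N_def sum_distrib_right by (subst sum.swap) (simp del: ind_Some)
    also have "\<dots> = (\<Sum>S\<in>F. 2)"
    proof (rule sum.cong[OF refl])
      fix S assume "S \<in> F"
      then consider p p' where "S = {p, p'}" "h p p'" | p where "S = {p}" "iso p"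
        by (auto simp: F_def)
      then show "(\<Sum>i\<in>UNIV. ind S (Some i) * a $ i) = 2"
      proof cases
        case 1
        then have "\<not> iso p" "\<not> iso p'" "p \<noteq> p'"
          using hsym[of p p'] unfolding iso_def h_def by blast+
        then show ?thesis unfolding ind_sum by (simp add: 1 a_def)
      next
        case 2
        then show ?thesis unfolding ind_sum by (simp add: a_def)
      qed
    qed
    finally have "(\<Sum>i\<in>UNIV. N None (Some i) * a $ i) = 2 * m" by (simp add: m)
    moreover have "(\<Sum>i\<in>UNIV. D None (Some i) * a $ i) = 1 / 2"
    proof -
      have "(\<Sum>i\<in>UNIV. D None (Some i) * a $ i)
          = (\<Sum>i\<in>UNIV. ind {v} (Some i) * a $ i - (ind {u} (Some i) * a $ i) / 2)"
        using huv by (intro sum.cong) auto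
      also have "\<dots> = (\<Sum>i\<in>UNIV. ind {v} (Some i) * a $ i) - (\<Sum>i\<in>UNIV. ind {u} (Some i) * a $ i) / 2"
        by (simp only: sum_subtractf sum_divide_distrib)
      also have "\<dots> = 1 / 2"
      proof -
        have "\<not> iso u" "\<not> iso v"
          using nbrs(1) hsym[OF nbrs(1)] unfolding iso_def by blast+
        then show ?thesis unfolding ind_sum by (simp add: a_def)
      qed
      finally show ?thesis .
    qed
    ultimately show ?thesis
      by (simp add: W_def distrib_right sum.distrib mult.assoc sum_distrib_left[symmetric])
  qed
  ultimately show False
    using e \<open>0 < m\<close> by (simp add: field_simps)
qed

section \<open>Odd cycles in the complement\<close>

text \<open>A longest path through \<open>r\<close> cannot be extended at its ends, and its inner
  vertices have no further neighbours, so it fills the component. Rigidity excludes a bipartite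
  component, which forces a closing edge and odd length.\<close>

lemma rigid_degree_two_component:
  fixes h :: "'a::finite \<Rightarrow> 'a \<Rightarrow> bool"
  assumes sym: "\<And>u v. h u v \<Longrightarrow> h v u"
    and irrefl: "\<And>u. \<not> h u u"
    and tri: "\<And>u v w. h u v \<Longrightarrow> h v w \<Longrightarrow> \<not> h u w"
    and deg: "\<And>u a b c. h u a \<Longrightarrow> h u b \<Longrightarrow> h u c \<Longrightarrow> a = b \<or> a = c \<or> b = c"
    and rigid: "\<And>(f :: 'a \<Rightarrow> real) u v. (\<And>p q. h p q \<Longrightarrow> f p + f q = 0) \<Longrightarrow> h u v \<Longrightarrow> f u = 0"
    and r: "h r s"
  obtains xs where "distinct xs" "set xs = {v. h\<^sup>*\<^sup>* r v}" "odd (length xs)" "5 \<le> length xs"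
    "\<And>i j. i < length xs \<Longrightarrow> j < length xs \<Longrightarrow>
       h (xs ! i) (xs ! j) \<longleftrightarrow> (i + 1) mod length xs = j \<or> (j + 1) mod length xs = i"
proof -
  \<comment> \<open>\<open>r\<close> may sit anywhere on the path, so maximality applies at both
    ends.\<close>
  define path where "path xs \<longleftrightarrow> distinct xs \<and> r \<in> set xs \<and> successively h xs" for xs
  have "path [r]"
    by (simp add: path_def)
  moreover have "\<forall>xs. path xs \<longrightarrow> length xs < Suc (CARD('a))"
    by (metis card_mono distinct_card finite_class.finite_UNIV le_imp_less_Suc path_def subset_UNIV)
  ultimately obtain xs where xs: "path xs" and longest: "\<And>ys. path ys \<Longrightarrow> length ys \<le> length xs"
    using ex_has_greatest_nat[of path "[r]" length "Suc (CARD('a))"] by blast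
  define n where "n = length xs"
  have dist: "distinct xs" and rin: "r \<in> set xs" and succ: "successively h xs"
    using xs by (auto simp: path_def)
  have n0: "0 < n"
    using rin by (auto simp: n_def)
  then have ne: "xs \<noteq> []"
    by (auto simp: n_def)
  have step: "h (xs ! i) (xs ! Suc i)" if "Suc i < n" for i
    using succ that by (simp add: successively_conv_nth n_def)
  have eq_iff: "xs ! i = xs ! j \<longleftrightarrow> i = j" if "i < n" "j < n" for i j
    using dist that by (simp add: nth_eq_iff_index_eq n_def)
  have first: "y \<in> set xs" if "h (xs ! 0) y" for y
  proof (rule ccontr)
    assume "y \<notin> set xs"
    then have "path (y # xs)"
      using xs sym[OF that] ne by (auto simp: path_def successively_Cons hd_conv_nth)
    from longest[OF this] show False by simp
  qed
  have last: "y \<in> set xs" if "h (xs ! (n - 1)) y" for y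
  proof (rule ccontr)
    assume "y \<notin> set xs"
    then have "path (xs @ [y])"
      using xs that ne by (auto simp: path_def successively_append_iff last_conv_nth n_def)
    from longest[OF this] show False by simp
  qed
  have inner: "y = xs ! (i - 1) \<or> y = xs ! Suc i" if "h (xs ! i) y" "0 < i" "Suc i < n" for i y
  proof -
    have "h (xs ! i) (xs ! (i - 1))"
      using step[of "i - 1"] that sym by simp
    moreover have "xs ! (i - 1) \<noteq> xs ! Suc i"
      using that by (subst eq_iff) auto
    ultimately show ?thesis
      using deg[OF that(1) _ step[OF that(3)]] by blast
  qed
  have closed: "y \<in> set xs" if "h (xs ! i) y" "i < n" for i y
  proof -
    consider "i = 0" | "i = n - 1" | "0 < i" "Suc i < n" using \<open>i < n\<close> by linarith
    then show ?thesis
    proof cases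
      case 3
      then show ?thesis
        using inner[OF that(1)] by (auto simp: n_def)
    qed (use that first last in auto)
  qed
  have adj: "j = Suc i \<or> i = Suc j \<or> (i = 0 \<and> j = n - 1) \<or> (j = 0 \<and> i = n - 1)"
    if "h (xs ! i) (xs ! j)" "i < n" "j < n" for i j
  proof -
    consider "0 < i" "Suc i < n" | "0 < j" "Suc j < n"
      | "i = 0 \<or> i = n - 1" "j = 0 \<or> j = n - 1"
    proof -
      have "k = 0 \<or> k = n - 1 \<or> (0 < k \<and> Suc k < n)" if "k < n" for k
        using that by linarith
      then show ?thesis
        using \<open>i < n\<close> \<open>j < n\<close> that by metis
    qed
    then show ?thesis
    proof cases
      case 1
      then have "j = i - 1 \<or> j = Suc i"
        using inner[OF that(1) 1] eq_iff that by auto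
      then show ?thesis using 1 by auto
    next
      case 2
      then have "i = j - 1 \<or> i = Suc j"
        using inner[OF sym[OF that(1)] 2] eq_iff that by auto
      then show ?thesis using 2 by auto
    next
      case 3
      then show ?thesis using that irrefl by auto
    qed
  qed
  have n2: "2 \<le> n"
  proof (rule ccontr)
    assume "\<not> 2 \<le> n"
    then have "n = 1" using n0 by simp
    then have "xs = [r]"
      using rin by (cases xs) (auto simp: n_def)
    then show False
      using first[of s] r irrefl by auto
  qed
  define ix where "ix = inv_into {..<n} ((!) xs)"
  have ix: "ix (xs ! i) = i" if "i < n" for i
    unfolding ix_def using eq_iff that by (intro inv_into_f_f) (auto simp: inj_on_def)
  have ends: "odd n \<and> h (xs ! 0) (xs ! (n - 1))"
  proof (rule ccontr)
    assume bip: "\<not> (odd n \<and> h (xs ! 0) (xs ! (n - 1)))"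
    \<comment> \<open>The alternating 2-colouring of a path or an even cycle contradicts rigidity.\<close>
    define f :: "'a \<Rightarrow> real" where "f x = (if x \<in> set xs then (- 1) ^ ix x else 0)" for x
    have anti: "f p + f q = 0" if "h p q" for p q
    proof (cases "p \<in> set xs")
      case False
      then have "q \<notin> set xs"
        using closed sym[OF that] by (metis in_set_conv_nth n_def)
      with False show ?thesis by (simp add: f_def)
    next
      case True
      then obtain i where i: "p = xs ! i" "i < n" by (metis in_set_conv_nth n_def)
      then have "q \<in> set xs" using closed that by blast
      then obtain j where j: "q = xs ! j" "j < n" by (metis in_set_conv_nth n_def)
      have f: "f p = (- 1) ^ i" "f q = (- 1) ^ j"
        using True \<open>q \<in> set xs\<close> by (auto simp: f_def i j ix)
      have "odd (i + j)"
      proof -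
        have "h (xs ! i) (xs ! j)" using i j that by simp
        from adj[OF this i(2) j(2)] consider "j = Suc i" | "i = Suc j"
          | "{i, j} = {0, n - 1}" by auto
        then show ?thesis
        proof cases
          case 3
          \<comment> \<open>The ends are adjacent here, so \<open>bip\<close> makes \<open>n\<close>
            even and the end positions differ in parity.\<close>
          then have "h (xs ! 0) (xs ! (n - 1))"
            using \<open>h (xs ! i) (xs ! j)\<close> sym by (auto simp: doubleton_eq_iff)
          with bip have "even n" by simp
          with 3 n0 show ?thesis by (auto simp: doubleton_eq_iff)
        qed auto
      qed
      then show ?thesis
        unfolding f by (cases "even i") auto
    qed
    have "f (xs ! 0) = 0"
      using rigid[of f, OF anti step[of 0]] n2 by simp
    then show False
      using ne by (simp add: f_def)
  qed
  have "n \<noteq> 3"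
    using tri[of "xs ! 0" "xs ! 1" "xs ! 2"] step[of 0] step[of 1] ends by (auto simp: numeral_2_eq_2)
  then have n5: "5 \<le> n"
    using ends[THEN conjunct1] n2 by presburger
  have cyc: "h (xs ! i) (xs ! j) \<longleftrightarrow> (i + 1) mod n = j \<or> (j + 1) mod n = i"
    if "i < n" "j < n" for i j
  proof
    assume "h (xs ! i) (xs ! j)"
    from adj[OF this that] show "(i + 1) mod n = j \<or> (j + 1) mod n = i"
      using that n0 by auto
  next
    have succ_mod: "h (xs ! k) (xs ! ((k + 1) mod n))" if "k < n" for k
      using ends sym step[of k] that by (cases "Suc k = n") auto
    assume "(i + 1) mod n = j \<or> (j + 1) mod n = i"
    then show "h (xs ! i) (xs ! j)"
      using succ_mod[of i] succ_mod[of j] sym that by auto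
  qed
  have reach0: "h\<^sup>*\<^sup>* (xs ! 0) (xs ! i)" if "i < n" for i
    using that
  proof (induction i)
    case (Suc i)
    then show ?case
      using rtranclp.rtrancl_into_rtrancl[of h "xs ! 0" "xs ! i" "xs ! Suc i"] step[of i] by simp
  qed simp
  have symr: "h\<^sup>*\<^sup>* v u" if "h\<^sup>*\<^sup>* u v" for u v
    using that symp_rtranclp[of h] sym by (metis sympD sympI)
  have "set xs = {v. h\<^sup>*\<^sup>* r v}"
  proof
    from rin obtain k where k: "k < n" "r = xs ! k" by (metis in_set_conv_nth n_def)
    show "set xs \<subseteq> {v. h\<^sup>*\<^sup>* r v}"
    proof
      fix v assume "v \<in> set xs"
      then obtain i where "i < n" "v = xs ! i" by (metis in_set_conv_nth n_def)
      then show "v \<in> {v. h\<^sup>*\<^sup>* r v}"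
        using rtranclp_trans[OF symr[OF reach0[OF k(1)]] reach0[of i]] k by simp
    qed
    have "v \<in> set xs" if "h\<^sup>*\<^sup>* r v" for v
      using that
    proof induction
      case (step y z)
      then show ?case using closed by (metis in_set_conv_nth n_def)
    qed (rule rin)
    then show "{v. h\<^sup>*\<^sup>* r v} \<subseteq> set xs" by auto
  qed
  with that dist ends n5 cyc show thesis
    unfolding n_def by blast
qed

section \<open>Assembling the join\<close>

text \<open>Components of \<open>h\<close> with an edge are odd cycles, hence antiholes of
  \<open>E\<close>; isolated vertices of \<open>h\<close> form the clique. No edge of
  \<open>h\<close> leaves a component, so in \<open>E\<close> each is joined to everything
  outside.\<close>

lemma rigid_degree_two_join:
  fixes E :: "'n::finite \<Rightarrow> 'n \<Rightarrow> bool"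
  defines "h \<equiv> \<lambda>u v. u \<noteq> v \<and> \<not> E u v"
  assumes sym: "\<And>u v. E u v \<Longrightarrow> E v u"
    and irrefl: "\<And>u. \<not> E u u"
    and tri: "\<And>u v w. h u v \<Longrightarrow> h v w \<Longrightarrow> \<not> h u w"
    and deg: "\<And>u a b c. h u a \<Longrightarrow> h u b \<Longrightarrow> h u c \<Longrightarrow> a = b \<or> a = c \<or> b = c"
    and rigid: "\<And>(f :: 'n \<Rightarrow> real) u v. (\<And>p q. h p q \<Longrightarrow> f p + f q = 0) \<Longrightarrow> h u v \<Longrightarrow> f u = 0"
    and edge: "h r s"
  shows "join_of_odd_antiholes_and_clique E"
proof -
  have hsym: "h v u" if "h u v" for u v
    using that sym by (auto simp: h_def)
  have hirr: "\<not> h u u" for u by (simp add: h_def)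
  define C where "C u = {v. h\<^sup>*\<^sup>* u v}" for u
  define P where "P = C ` {u. \<exists>v. h u v}"
  define K where "K = {u. \<nexists>v. h u v}"
  have symr: "h\<^sup>*\<^sup>* v u" if "h\<^sup>*\<^sup>* u v" for u v
    using that symp_rtranclp[of h] hsym by (metis sympD sympI)
  have C_eq: "C u = C v" if "v \<in> C u" for u v
    using that rtranclp_trans[of h] symr[of u v] unfolding C_def by blast
  have C_nonisol: "\<exists>w. h v w" if "v \<in> C u" "h u u'" for u u' v
    using that unfolding C_def mem_Collect_eq
    by (induction rule: rtranclp_induct) (auto dest: hsym)
  have hole: "odd_antihole_on E (C u)" if uv: "h u v" for u v
  proof -
    obtain xs where xs: "distinct xs" "set xs = C u" "odd (length xs)" "5 \<le> length xs"
      "\<And>i j. i < length xs \<Longrightarrow> j < length xs \<Longrightarrow>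
       h (xs ! i) (xs ! j) \<longleftrightarrow> (i + 1) mod length xs = j \<or> (j + 1) mod length xs = i"
      unfolding C_def
      by (rule rigid_degree_two_component[of h u v]) (use hsym hirr tri deg rigid uv in blast)+
    define ix where "ix = inv_into {0..<length xs} ((!) xs)"
    have bij: "bij_betw ((!) xs) {0..<length xs} (C u)"
      using xs(1,2) by (simp add: bij_betw_nth atLeast0LessThan)
    have ix: "ix (xs ! i) = i" if "i < length xs" for i
      unfolding ix_def using bij that by (intro inv_into_f_f) (auto simp: bij_betw_def)
    have "E p q \<longleftrightarrow> p \<noteq> q \<and> (ix p + 1) mod length xs \<noteq> ix q \<and> (ix q + 1) mod length xs \<noteq> ix p"
      if pq: "p \<in> C u" "q \<in> C u" for p q
    proof -
      obtain i j where ij: "p = xs ! i" "q = xs ! j" "i < length xs" "j < length xs"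
        using pq xs(2) by (metis in_set_conv_nth)
      have "E p q \<longleftrightarrow> p \<noteq> q \<and> \<not> h p q"
        using irrefl by (auto simp: h_def)
      then show ?thesis
        unfolding ij(1,2) xs(5)[OF ij(3,4)] ix[OF ij(3)] ix[OF ij(4)] by auto
    qed
    then show ?thesis
      unfolding odd_antihole_on_def
      using xs(3,4) bij_betw_inv_into[OF bij] by (auto simp: ix_def[symmetric])
  qed
  have "P \<noteq> {}" using edge by (auto simp: P_def)
  moreover have "\<forall>A\<in>P. \<forall>B\<in>P. A \<noteq> B \<longrightarrow> A \<inter> B = {}"
    unfolding P_def using C_eq by blast
  moreover have "\<forall>A\<in>P. A \<inter> K = {}"
    unfolding P_def K_def using C_nonisol by blast
  moreover have "\<Union>P \<union> K = UNIV"
    unfolding P_def K_def C_def by auto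
  moreover have "\<forall>A\<in>P. odd_antihole_on E A"
    unfolding P_def using hole by blast
  moreover have "is_clique E K"
    unfolding is_clique_def K_def h_def by auto
  moreover have "\<forall>A\<in>P. \<forall>u\<in>A. \<forall>v. v \<notin> A \<longrightarrow> E u v"
  proof (intro ballI allI impI)
    fix A u v assume *: "A \<in> P" "u \<in> A" "v \<notin> A"
    then obtain w where w: "A = C w" by (auto simp: P_def)
    have "\<not> h u v"
      using * rtranclp.rtrancl_into_rtrancl[of h w u v] unfolding w C_def by blast
    then show "E u v" using * by (auto simp: h_def)
  qed
  ultimately show ?thesis
    unfolding join_of_odd_antiholes_and_clique_def
    by (intro exI[of _ P] exI[of _ K]) (simp add: P_def)
qed

theorem theorem6:
  fixes E :: "'n::finite \<Rightarrow> 'n \<Rightarrow> bool"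
  assumes sym: "\<And>u v. E u v \<Longrightarrow> E v u"
    and irrefl: "\<And>u. \<not> E u u"
    and alpha: "stability_number E = 2"
    and facet: "facet_defining E"
    and lsp: "LS_plus_perfect E"
  shows "odd_antihole_on E UNIV \<or> join_of_odd_antiholes_and_clique E"
proof -
  have card: "card S \<le> 2" if "stable_set E S" for S
    using stable_set_card_le_stability_number[OF that] alpha by simp
  have rigid: "f u = 0" if "\<And>p q. p \<noteq> q \<and> \<not> E p q \<Longrightarrow> f p + f q = 0" "u \<noteq> v \<and> \<not> E u v"
    for f :: "'n \<Rightarrow> real" and u v
    using facet_rigid[OF sym irrefl alpha facet, of f u v] that by blast
  have tri: "\<not> (u \<noteq> w \<and> \<not> E u w)" if "u \<noteq> v \<and> \<not> E u v" "v \<noteq> w \<and> \<not> E v w" for u v w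
  proof
    assume "u \<noteq> w \<and> \<not> E u w"
    with that have "stable_set E {u, v, w}" "card {u, v, w} = 3"
      using sym irrefl by (auto simp: stable_set_def)
    then show False using card by fastforce
  qed
  have deg: "a = b \<or> a = c \<or> b = c"
    if "u \<noteq> a \<and> \<not> E u a" "u \<noteq> b \<and> \<not> E u b" "u \<noteq> c \<and> \<not> E u c" for u a b c
    by (rule degree_le_two_if_LS_plus_perfect[OF sym irrefl card _ lsp that]) (assumption | rule rigid)+
  \<comment> \<open>A stable pair is an edge of the complement, so there is at least one
    antihole.\<close>
  obtain S where "stable_set E S" "card S = 2"
    using stability_number_attained[of E] alpha by metis
  then obtain r s where "r \<noteq> s \<and> \<not> E r s"
    by (auto simp: stable_set_def card_2_iff)
  \<comment> \<open>A single antihole is the join with one part and an empty clique.\<close>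
  then have "join_of_odd_antiholes_and_clique E"
  proof (rule rigid_degree_two_join[OF sym irrefl tri deg, rotated -1])
    show "f u = 0" if "\<And>p q. p \<noteq> q \<and> \<not> E p q \<Longrightarrow> f p + f q = 0" "u \<noteq> v \<and> \<not> E u v"
      for f :: "'n \<Rightarrow> real" and u v
      using that by (rule rigid)
  qed
  then show ?thesis ..
qed

end
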